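(* Let $\kappa$ be an infinite cardinal. If a Boolean algebra supports a uniformly $\kappa$-regular (non-atomic) measure, then it is isomorphic to a subalgebra of the $\sigma$-completion of a quotient of $\mathrm{Free}(\kappa)$.
   Context: A measure on a Boolean algebra is a finitely additive non-negative finite function, normalized to have value $1$ at the unit. An algebra supports $\mu$ if $\mu$ is defined on all of it and strictly positive; $\mu$ is non-atomic if for every $\varepsilon>0$ there is a finite partition of unity into elements of measure at most $\varepsilon$. A family $\mathcal{F}\subseteq\mathfrak{B}$ is uniformly $\mu$-dense if for every $b\in\mathfrak{B}$ and $\varepsilon>0$ there is $a\in\mathcal{F}$ with $a\le b$ and $\mu(b\setminus a)<\varepsilon$; $\mathrm{ur}(\mu)$ is the least cardinality of a uniformly $\mu$-dense family. For $b\ne\mathbf{0}$, $\mu\,|\,b$ is the restriction of $\mu$ to $\{c\in\mathfrak{B}:c\le b\}$. An element $a$ is uniform if $\mathrm{ur}(\mu\,|\,b)=\mathrm{ur}(\mu\,|\,a)$ for every $\mathbf{0}\ne b\le a$. $\mu$ is uniformly $\kappa$-regular if $\mathbf{1}$ is a uniform element and $\mathrm{ur}(\mu)=\kappa$. $\mathrm{Free}(\kappa)$ is the free Boolean algebra on $\kappa$ generators. The $\sigma$-completion of a Boolean algebra is the smallest $\sigma$-complete subalgebra (closed under countable joins) of its completion containing it. Isomorphisms and subalgebras are only with respect to finitary Boolean operations. *)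

theory Defs
  imports Complex_Main "HOL-Algebra.Complete_Lattice" "HOL-Library.Countable_Set"
begin

unbundle cardinal_syntax

section \<open>Boolean algebras\<close>

text \<open>
  A Boolean algebra is a complemented distributive lattice given on an explicit carrier, so that
  relative algebras, subalgebras and quotients are again objects of the same kind.  The operations
  are those that HOL-Algebra derives from the order.
\<close>

locale boolean_lattice = bounded_lattice L for L (structure) +
  assumes meet_join_distrib:
      "\<lbrakk>x \<in> carrier L; y \<in> carrier L; z \<in> carrier L\<rbrakk>
        \<Longrightarrow> x \<sqinter> (y \<squnion> z) = (x \<sqinter> y) \<squnion> (x \<sqinter> z)"
    and complement_exists:
      "x \<in> carrier L \<Longrightarrow> \<exists>y \<in> carrier L. x \<squnion> y = \<top> \<and> x \<sqinter> y = \<bottom>"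

definition complement :: "('a, 'm) gorder_scheme \<Rightarrow> 'a \<Rightarrow> 'a" where
  "complement L x = (THE y. y \<in> carrier L \<and> x \<squnion>\<^bsub>L\<^esub> y = \<top>\<^bsub>L\<^esub> \<and> x \<sqinter>\<^bsub>L\<^esub> y = \<bottom>\<^bsub>L\<^esub>)"

definition difference :: "('a, 'm) gorder_scheme \<Rightarrow> 'a \<Rightarrow> 'a \<Rightarrow> 'a" where
  "difference L x y = x \<sqinter>\<^bsub>L\<^esub> complement L y"

definition boolean_subalgebra :: "'a set \<Rightarrow> ('a, 'm) gorder_scheme \<Rightarrow> bool" where
  "boolean_subalgebra S L \<longleftrightarrow> S \<subseteq> carrier L \<and> \<bottom>\<^bsub>L\<^esub> \<in> S \<and> \<top>\<^bsub>L\<^esub> \<in> S \<and>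
     (\<forall>x \<in> S. complement L x \<in> S) \<and>
     (\<forall>x \<in> S. \<forall>y \<in> S. x \<squnion>\<^bsub>L\<^esub> y \<in> S \<and> x \<sqinter>\<^bsub>L\<^esub> y \<in> S)"

definition boolean_iso :: "('a, 'm) gorder_scheme \<Rightarrow> ('b, 'n) gorder_scheme \<Rightarrow> ('a \<Rightarrow> 'b) \<Rightarrow> bool" where
  "boolean_iso L M h \<longleftrightarrow> bij_betw h (carrier L) (carrier M) \<and>
     h \<bottom>\<^bsub>L\<^esub> = \<bottom>\<^bsub>M\<^esub> \<and> h \<top>\<^bsub>L\<^esub> = \<top>\<^bsub>M\<^esub> \<and>
     (\<forall>x \<in> carrier L. h (complement L x) = complement M (h x)) \<and>
     (\<forall>x \<in> carrier L. \<forall>y \<in> carrier L.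
        h (x \<squnion>\<^bsub>L\<^esub> y) = h x \<squnion>\<^bsub>M\<^esub> h y \<and> h (x \<sqinter>\<^bsub>L\<^esub> y) = h x \<sqinter>\<^bsub>M\<^esub> h y)"

definition boolean_isomorphic :: "('a, 'm) gorder_scheme \<Rightarrow> ('b, 'n) gorder_scheme \<Rightarrow> bool" where
  "boolean_isomorphic L M \<longleftrightarrow> (\<exists>h. boolean_iso L M h)"


section \<open>Measures\<close>

definition boolean_measure :: "('a, 'm) gorder_scheme \<Rightarrow> ('a \<Rightarrow> real) \<Rightarrow> bool" where
  "boolean_measure B \<mu> \<longleftrightarrow> (\<forall>x \<in> carrier B. 0 \<le> \<mu> x) \<and> \<mu> \<top>\<^bsub>B\<^esub> = 1 \<and>
     (\<forall>x \<in> carrier B. \<forall>y \<in> carrier B. x \<sqinter>\<^bsub>B\<^esub> y = \<bottom>\<^bsub>B\<^esub> \<longrightarrow> \<mu> (x \<squnion>\<^bsub>B\<^esub> y) = \<mu> x + \<mu> y)"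

definition supports :: "('a, 'm) gorder_scheme \<Rightarrow> ('a \<Rightarrow> real) \<Rightarrow> bool" where
  "supports B \<mu> \<longleftrightarrow> boolean_measure B \<mu> \<and> (\<forall>x \<in> carrier B. x \<noteq> \<bottom>\<^bsub>B\<^esub> \<longrightarrow> 0 < \<mu> x)"

definition partition_of_unity :: "('a, 'm) gorder_scheme \<Rightarrow> 'a set \<Rightarrow> bool" where
  "partition_of_unity B P \<longleftrightarrow> P \<subseteq> carrier B \<and>
     (\<forall>x \<in> P. \<forall>y \<in> P. x \<noteq> y \<longrightarrow> x \<sqinter>\<^bsub>B\<^esub> y = \<bottom>\<^bsub>B\<^esub>) \<and> \<Squnion>\<^bsub>B\<^esub>P = \<top>\<^bsub>B\<^esub>"

definition non_atomic :: "('a, 'm) gorder_scheme \<Rightarrow> ('a \<Rightarrow> real) \<Rightarrow> bool" where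
  "non_atomic B \<mu> \<longleftrightarrow>
     (\<forall>\<epsilon>>0. \<exists>P. finite P \<and> partition_of_unity B P \<and> (\<forall>x \<in> P. \<mu> x \<le> \<epsilon>))"

definition uniformly_dense :: "('a, 'm) gorder_scheme \<Rightarrow> ('a \<Rightarrow> real) \<Rightarrow> 'a set \<Rightarrow> bool" where
  "uniformly_dense B \<mu> F \<longleftrightarrow> F \<subseteq> carrier B \<and>
     (\<forall>b \<in> carrier B. \<forall>\<epsilon>>0. \<exists>a \<in> F. a \<sqsubseteq>\<^bsub>B\<^esub> b \<and> \<mu> (difference B b a) < \<epsilon>)"

text \<open>
  The cardinal \<open>ur(\<mu>)\<close> is represented, as in the library's theory of cardinals, by a cardinal
  order, to be compared by \<open>=o\<close>: that of a uniformly dense family of least cardinality (which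
  exists because cardinals are well-ordered).
\<close>

definition ur :: "('a, 'm) gorder_scheme \<Rightarrow> ('a \<Rightarrow> real) \<Rightarrow> 'a rel" where
  "ur B \<mu> = card_of (SOME F. uniformly_dense B \<mu> F \<and>
     (\<forall>G. uniformly_dense B \<mu> G \<longrightarrow> card_of F \<le>o card_of G))"

text \<open>
  The algebra on which \<open>\<mu> | b\<close> lives; \<open>\<mu>\<close> itself need not be changed, since its values outside
  the carrier are irrelevant.
\<close>

definition relative_algebra :: "('a, 'm) gorder_scheme \<Rightarrow> 'a \<Rightarrow> ('a, 'm) gorder_scheme" where
  "relative_algebra B b = B\<lparr>carrier := {c \<in> carrier B. c \<sqsubseteq>\<^bsub>B\<^esub> b}\<rparr>"

definition uniform_element :: "('a, 'm) gorder_scheme \<Rightarrow> ('a \<Rightarrow> real) \<Rightarrow> 'a \<Rightarrow> bool" where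
  "uniform_element B \<mu> a \<longleftrightarrow> a \<in> carrier B \<and>
     (\<forall>b \<in> carrier B. b \<noteq> \<bottom>\<^bsub>B\<^esub> \<and> b \<sqsubseteq>\<^bsub>B\<^esub> a \<longrightarrow>
        ur (relative_algebra B b) \<mu> =o ur (relative_algebra B a) \<mu>)"

definition uniformly_regular :: "'k rel \<Rightarrow> ('a, 'm) gorder_scheme \<Rightarrow> ('a \<Rightarrow> real) \<Rightarrow> bool" where
  "uniformly_regular \<kappa> B \<mu> \<longleftrightarrow> uniform_element B \<mu> \<top>\<^bsub>B\<^esub> \<and> ur B \<mu> =o \<kappa>"


section \<open>Free algebras, quotients and completions\<close>

text \<open>
  The free algebra on the set \<open>K\<close> is realised as the algebra of clopen subsets of the
  Cantor cube \<open>2\<^sup>K\<close> (identified with the power set of \<open>K\<close>): it is generated by the independent sets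
  \<open>{X. i \<in> X}\<close> for \<open>i \<in> K\<close>.
\<close>

inductive_set clopen_sets :: "'k set \<Rightarrow> 'k set set set" for K :: "'k set" where
  generator: "i \<in> K \<Longrightarrow> {X \<in> Pow K. i \<in> X} \<in> clopen_sets K"
| empty: "{} \<in> clopen_sets K"
| compl: "a \<in> clopen_sets K \<Longrightarrow> Pow K - a \<in> clopen_sets K"
| union: "\<lbrakk>a \<in> clopen_sets K; b \<in> clopen_sets K\<rbrakk> \<Longrightarrow> a \<union> b \<in> clopen_sets K"

definition free_algebra :: "'k set \<Rightarrow> 'k set set gorder" where
  "free_algebra K = \<lparr>carrier = clopen_sets K, eq = (=), le = (\<subseteq>)\<rparr>"

definition boolean_ideal :: "'a set \<Rightarrow> ('a, 'm) gorder_scheme \<Rightarrow> bool" where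
  "boolean_ideal I L \<longleftrightarrow> I \<subseteq> carrier L \<and> \<bottom>\<^bsub>L\<^esub> \<in> I \<and>
     (\<forall>x \<in> I. \<forall>y \<in> I. x \<squnion>\<^bsub>L\<^esub> y \<in> I) \<and>
     (\<forall>x \<in> I. \<forall>y \<in> carrier L. y \<sqsubseteq>\<^bsub>L\<^esub> x \<longrightarrow> y \<in> I)"

definition ideal_cong :: "('a, 'm) gorder_scheme \<Rightarrow> 'a set \<Rightarrow> 'a rel" where
  "ideal_cong L I = {(x, y). x \<in> carrier L \<and> y \<in> carrier L \<and>
     difference L x y \<squnion>\<^bsub>L\<^esub> difference L y x \<in> I}"

definition quotient_algebra :: "('a, 'm) gorder_scheme \<Rightarrow> 'a set \<Rightarrow> 'a set gorder" where
  "quotient_algebra L I = \<lparr>carrier = carrier L // ideal_cong L I, eq = (=),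
     le = (\<lambda>X Y. \<exists>x \<in> X. \<exists>y \<in> Y. difference L x y \<in> I)\<rparr>"

text \<open>
  The completion is the Dedekind-MacNeille completion: its elements are the cuts, i.e. the sets
  that coincide with the set of lower bounds of their upper bounds, ordered by inclusion.  The
  element \<open>a\<close> of the algebra is identified with the principal cut \<open>{c. c \<le> a}\<close>.
\<close>

definition completion :: "('a, 'm) gorder_scheme \<Rightarrow> 'a set gorder" where
  "completion L = \<lparr>carrier = {X. X \<subseteq> carrier L \<and> Lower L (Upper L X) = X}, eq = (=), le = (\<subseteq>)\<rparr>"

definition principal_cut :: "('a, 'm) gorder_scheme \<Rightarrow> 'a \<Rightarrow> 'a set" where
  "principal_cut L a = {c \<in> carrier L. c \<sqsubseteq>\<^bsub>L\<^esub> a}"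

definition sigma_subalgebra :: "'a set \<Rightarrow> ('a, 'm) gorder_scheme \<Rightarrow> bool" where
  "sigma_subalgebra S L \<longleftrightarrow> boolean_subalgebra S L \<and>
     (\<forall>A. A \<subseteq> S \<and> countable A \<longrightarrow> \<Squnion>\<^bsub>L\<^esub>A \<in> S)"

definition sigma_completion :: "('a, 'm) gorder_scheme \<Rightarrow> 'a set gorder" where
  "sigma_completion L = (completion L)\<lparr>carrier :=
     \<Inter>{S. sigma_subalgebra S (completion L) \<and> principal_cut L ` carrier L \<subseteq> S}\<rparr>"

end

(*
  Let F be a uniformly mu-dense family of cardinality kappa.  Every b in B is the supremum in B of
  countably many members of F: if a_n <= b and mu(b - a_n) < 1/n, then an upper bound c of all a_n
  satisfies mu(b - c) = 0, so b <= c.  Map the generators of Free(kappa) onto F and let I be the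
  kernel of the induced homomorphism.  The quotient Q = Free(kappa)/I is a dense subalgebra of B, so
  b |-> {q in Q. q <= b} embeds B in the completion of Q, and since each of these cuts is a
  countable supremum of principal ones, B lands in the sigma-completion.
*)
theory Submission
  imports Defs
begin

text \<open>\<open>Q\<close> approximates \<open>B\<close> from both sides. From below this is
  density. From above it comes from complements: if p is not below b, the part of p outside b
  contains a nonzero q of \<open>Q\<close>, and the complement of q lies above b but not above p.
  This makes the elements of \<open>Q\<close> below b a cut, and it lets a supremum taken in
  \<open>B\<close> remain a supremum in the completion. Two obstacles shape the rest. The operations
  of HOL-Algebra are choices determined by the order and the carrier, so they have to be evaluated
  separately in the completion, in the sigma-completion and in the image of \<open>B\<close>; one
  treatment of families of cuts closed under intersections and hulls of unions serves all three.
  Moreover, the free algebra is a concrete algebra of sets, so the homomorphism whose kernel is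
  wanted exists only once its value is shown not to depend on how a clopen set is built from
  generators.\<close>

section \<open>Boolean lattices\<close>

context boolean_lattice
begin

lemma le_bottom_iff: "x \<in> carrier L \<Longrightarrow> x \<sqsubseteq> \<bottom> \<longleftrightarrow> x = \<bottom>"
  using le_antisym[of x \<bottom>] bottom_lower[of x] by auto

lemma top_le_iff: "x \<in> carrier L \<Longrightarrow> \<top> \<sqsubseteq> x \<longleftrightarrow> x = \<top>"
  using le_antisym[of x \<top>] top_higher[of x] by auto

lemma le_meet_iff:
  assumes "x \<in> carrier L" "y \<in> carrier L" "z \<in> carrier L"
  shows "z \<sqsubseteq> x \<sqinter> y \<longleftrightarrow> z \<sqsubseteq> x \<and> z \<sqsubseteq> y"
  using assms meet_left[of x y] meet_right[of x y] meet_le[of z x y]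
    le_trans[of z "x \<sqinter> y" x] le_trans[of z "x \<sqinter> y" y] by auto

lemma join_le_iff:
  assumes "x \<in> carrier L" "y \<in> carrier L" "z \<in> carrier L"
  shows "x \<squnion> y \<sqsubseteq> z \<longleftrightarrow> x \<sqsubseteq> z \<and> y \<sqsubseteq> z"
  using assms join_left[of x y] join_right[of x y] join_le[of x z y]
    le_trans[of x "x \<squnion> y" z] le_trans[of y "x \<squnion> y" z] by auto

text \<open>Puts disjointness in terms of the order, so that it passes to smaller elements by
  transitivity.\<close>

lemma meet_bottom_iff:
  assumes "x \<in> carrier L" "y \<in> carrier L"
  shows "x \<sqinter> y = \<bottom> \<longleftrightarrow> (\<forall>z \<in> carrier L. z \<sqsubseteq> x \<longrightarrow> z \<sqsubseteq> y \<longrightarrow> z = \<bottom>)"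
proof
  assume "x \<sqinter> y = \<bottom>"
  then show "\<forall>z \<in> carrier L. z \<sqsubseteq> x \<longrightarrow> z \<sqsubseteq> y \<longrightarrow> z = \<bottom>"
    using assms le_meet_iff[of x y] le_bottom_iff by auto
next
  assume "\<forall>z \<in> carrier L. z \<sqsubseteq> x \<longrightarrow> z \<sqsubseteq> y \<longrightarrow> z = \<bottom>"
  then show "x \<sqinter> y = \<bottom>"
    using assms meet_left[of x y] meet_right[of x y] meet_closed[of x y] by simp
qed

text \<open>Distributivity gives z = (z meet x) join (z meet y) = z meet y. Uniqueness of
  complements and both laws \<open>le_complement_iff\<close> and \<open>complement_le_iff\<close>
  rest on this.\<close>

lemma le_if_join_top_meet_bottom:
  assumes "x \<in> carrier L" "y \<in> carrier L" "z \<in> carrier L"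
    and "x \<squnion> y = \<top>" "x \<sqinter> z = \<bottom>"
  shows "z \<sqsubseteq> y"
proof -
  have "z = z \<sqinter> (x \<squnion> y)"
    using assms le_iff_join[of z \<top>] by (simp add: top_higher)
  also have "\<dots> = (z \<sqinter> x) \<squnion> (z \<sqinter> y)"
    using assms(1-3) by (simp only: meet_join_distrib)
  also have "\<dots> = \<bottom> \<squnion> (z \<sqinter> y)"
    using assms by (simp only: meet_comm[of L z x])
  also have "\<dots> = z \<sqinter> y"
    using assms le_iff_meet[of \<bottom> "z \<sqinter> y"] by (simp add: bottom_lower)
  finally show ?thesis
    using assms meet_right[of z y] by simp
qed

lemma complement_eqI:
  assumes "x \<in> carrier L" "y \<in> carrier L" "x \<squnion> y = \<top>" "x \<sqinter> y = \<bottom>"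
  shows "complement L x = y"
  unfolding complement_def
proof (rule the_equality)
  fix z assume z: "z \<in> carrier L \<and> x \<squnion> z = \<top> \<and> x \<sqinter> z = \<bottom>"
  show "z = y"
    using z assms le_if_join_top_meet_bottom[of x y z] le_if_join_top_meet_bottom[of x z y]
    by (intro le_antisym) auto
qed (use assms in auto)

lemma
  assumes "x \<in> carrier L"
  shows complement_closed [simp]: "complement L x \<in> carrier L"
    and join_complement: "x \<squnion> complement L x = \<top>"
    and meet_complement: "x \<sqinter> complement L x = \<bottom>"
  using complement_exists[OF assms] complement_eqI[OF assms] by auto

lemma complement_complement: "x \<in> carrier L \<Longrightarrow> complement L (complement L x) = x"
  by (rule complement_eqI)
    (simp_all add: join_comm[of L "complement L x"] join_complement
      meet_comm[of L "complement L x"] meet_complement)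

lemma le_complement_iff:
  assumes "x \<in> carrier L" "y \<in> carrier L"
  shows "y \<sqsubseteq> complement L x \<longleftrightarrow> x \<sqinter> y = \<bottom>"
proof
  assume *: "y \<sqsubseteq> complement L x"
  have "z = \<bottom>" if "z \<in> carrier L" "z \<sqsubseteq> x" "z \<sqsubseteq> y" for z
  proof -
    have "z \<sqsubseteq> complement L x"
      using le_trans[OF that(3) *] that assms by simp
    then show ?thesis
      using that assms meet_complement[OF assms(1)] by (simp add: meet_bottom_iff)
  qed
  then show "x \<sqinter> y = \<bottom>"
    using assms by (simp add: meet_bottom_iff)
next
  assume "x \<sqinter> y = \<bottom>"
  then show "y \<sqsubseteq> complement L x"
    using le_if_join_top_meet_bottom[of x "complement L x" y] assms
    by (simp add: join_complement)
qed

lemma le_iff_meet_complement: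
  assumes "x \<in> carrier L" "y \<in> carrier L"
  shows "x \<sqsubseteq> y \<longleftrightarrow> x \<sqinter> complement L y = \<bottom>"
  using le_complement_iff[of "complement L y" x] assms
  by (simp add: complement_complement meet_comm[of L x])

lemma complement_le_iff:
  assumes "x \<in> carrier L" "y \<in> carrier L"
  shows "complement L x \<sqsubseteq> y \<longleftrightarrow> x \<squnion> y = \<top>"
proof
  assume *: "complement L x \<sqsubseteq> y"
  have "complement L x \<sqsubseteq> x \<squnion> y"
    using le_trans[OF * join_right[of x y]] assms by simp
  then have "x \<squnion> complement L x \<sqsubseteq> x \<squnion> y"
    using assms by (simp add: join_le_iff join_left)
  then show "x \<squnion> y = \<top>"
    using assms by (simp add: join_complement top_le_iff)
next
  assume "x \<squnion> y = \<top>"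
  then show "complement L x \<sqsubseteq> y"
    using le_if_join_top_meet_bottom[of x y "complement L x"] assms
    by (simp add: meet_complement)
qed

text \<open>The disjoint decomposition to which additivity of a measure is applied in
  \<open>supports_mono\<close>.\<close>

lemma join_meet_complement:
  assumes "x \<in> carrier L" "y \<in> carrier L" "x \<sqsubseteq> y"
  shows "x \<squnion> (y \<sqinter> complement L x) = y"
proof (rule le_antisym)
  show "x \<squnion> (y \<sqinter> complement L x) \<sqsubseteq> y"
    using assms by (simp add: join_le_iff meet_left)
  have "y = y \<sqinter> (x \<squnion> complement L x)"
    using assms le_iff_join[of y \<top>] by (simp add: join_complement top_higher)
  also have "\<dots> = (y \<sqinter> x) \<squnion> (y \<sqinter> complement L x)"
    using assms by (simp add: meet_join_distrib)
  also have "\<dots> \<sqsubseteq> x \<squnion> (y \<sqinter> complement L x)"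
    using assms le_trans[OF meet_right[of y x] join_left[of x "y \<sqinter> complement L x"]]
    by (simp add: join_le_iff join_right)
  finally show "y \<sqsubseteq> x \<squnion> (y \<sqinter> complement L x)" .
qed (use assms in simp_all)

end

text \<open>Bottoms and suprema are \<open>SOME\<close> least element. Under inclusion a least
  element is unique, so exhibiting one evaluates the operator; this serves both the completion and
  the free algebra.\<close>

lemma some_least_inclusion:
  assumes "\<And>X Y. X \<sqsubseteq>\<^bsub>L\<^esub> Y \<longleftrightarrow> X \<subseteq> Y" "least L X A"
  shows "(SOME Y. least L Y A) = X"
proof (rule some_equality[of _ X])
  fix Y assume "least L Y A"
  then have "Y \<subseteq> X" "X \<subseteq> Y"
    using assms(2) by (simp_all add: least_def assms(1))
  then show "Y = X"
    by blast
qed (rule assms(2))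

lemma some_greatest_inclusion:
  assumes "\<And>X Y. X \<sqsubseteq>\<^bsub>L\<^esub> Y \<longleftrightarrow> X \<subseteq> Y" "greatest L X A"
  shows "(SOME Y. greatest L Y A) = X"
proof (rule some_equality[of _ X])
  fix Y assume "greatest L Y A"
  then have "Y \<subseteq> X" "X \<subseteq> Y"
    using assms(2) by (simp_all add: greatest_def assms(1))
  then show "Y = X"
    by blast
qed (rule assms(2))

section \<open>Countably dense subalgebras\<close>

text \<open>\<open>Q\<close> enters only through its order, which \<open>\<phi>\<close> reflects, so
  that all lattice computations take place in \<open>B\<close>. Closure of the image under
  complements supplies the approximation from above.\<close>

locale sigma_dense_embedding = boolean_lattice B for B :: "('a, 'm) gorder_scheme" (structure) +
  fixes Q :: "('q, 'n) gorder_scheme" and \<phi> :: "'q \<Rightarrow> 'a"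
  assumes emb_closed: "q \<in> carrier Q \<Longrightarrow> \<phi> q \<in> carrier B"
    and emb_le_iff: "\<lbrakk>p \<in> carrier Q; q \<in> carrier Q\<rbrakk> \<Longrightarrow> p \<sqsubseteq>\<^bsub>Q\<^esub> q \<longleftrightarrow> \<phi> p \<sqsubseteq> \<phi> q"
    and emb_complement: "q \<in> carrier Q \<Longrightarrow> \<exists>p \<in> carrier Q. \<phi> p = complement B (\<phi> q)"
    and sigma_dense:
      "b \<in> carrier B \<Longrightarrow> \<exists>D \<subseteq> carrier Q. countable D \<and> least B b (Upper B (\<phi> ` D))"
begin

definition cut :: "'a \<Rightarrow> 'q set" where
  "cut b = {q \<in> carrier Q. \<phi> q \<sqsubseteq> b}"

lemma principal_cut_eq: "q \<in> carrier Q \<Longrightarrow> principal_cut Q q = cut (\<phi> q)"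
  by (auto simp: principal_cut_def cut_def emb_le_iff)

text \<open>The universal property of a supremum as one equivalence; taking b for c recovers that b
  is an upper bound.\<close>

lemma least_Upper_image_iff:
  assumes "D \<subseteq> carrier Q" "b \<in> carrier B"
  shows "least B b (Upper B (\<phi> ` D)) \<longleftrightarrow>
    (\<forall>c \<in> carrier B. b \<sqsubseteq> c \<longleftrightarrow> (\<forall>q \<in> D. \<phi> q \<sqsubseteq> c))"
proof -
  have closed: "\<phi> q \<in> carrier B" if "q \<in> D" for q
    using that assms(1) emb_closed by blast
  have "Upper B (\<phi> ` D) = {c \<in> carrier B. \<forall>q \<in> D. \<phi> q \<sqsubseteq> c}"
    using closed by (auto simp: Upper_def)
  then have "least B b (Upper B (\<phi> ` D)) \<longleftrightarrow>
      (\<forall>q \<in> D. \<phi> q \<sqsubseteq> b) \<and> (\<forall>c \<in> carrier B. (\<forall>q \<in> D. \<phi> q \<sqsubseteq> c) \<longrightarrow> b \<sqsubseteq> c)"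
    using assms(2) by (auto simp: least_def)
  also have "\<dots> \<longleftrightarrow> (\<forall>c \<in> carrier B. b \<sqsubseteq> c \<longleftrightarrow> (\<forall>q \<in> D. \<phi> q \<sqsubseteq> c))"
  proof safe
    fix c q assume "\<forall>q \<in> D. \<phi> q \<sqsubseteq> b" "b \<sqsubseteq> c" "c \<in> carrier B" "q \<in> D"
    then show "\<phi> q \<sqsubseteq> c"
      using le_trans[of "\<phi> q" b c] closed assms(2) by simp
  next
    fix q assume *: "\<forall>c \<in> carrier B. b \<sqsubseteq> c \<longleftrightarrow> (\<forall>q \<in> D. \<phi> q \<sqsubseteq> c)" and "q \<in> D"
    then show "\<phi> q \<sqsubseteq> b"
      using bspec[OF * assms(2)] le_refl[OF assms(2)] by simp
  qed simp_all
  finally show ?thesis .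
qed

lemma le_if_dense:
  assumes "b \<in> carrier B" "c \<in> carrier B" "\<And>q. \<lbrakk>q \<in> carrier Q; \<phi> q \<sqsubseteq> b\<rbrakk> \<Longrightarrow> \<phi> q \<sqsubseteq> c"
  shows "b \<sqsubseteq> c"
proof -
  obtain D where D: "D \<subseteq> carrier Q" "least B b (Upper B (\<phi> ` D))"
    using sigma_dense assms(1) by blast
  then have *: "b \<sqsubseteq> d \<longleftrightarrow> (\<forall>q \<in> D. \<phi> q \<sqsubseteq> d)" if "d \<in> carrier B" for d
    using assms(1) that by (simp add: least_Upper_image_iff)
  have "\<forall>q \<in> D. \<phi> q \<sqsubseteq> b"
    using *[OF assms(1)] le_refl[OF assms(1)] by simp
  then show ?thesis
    using *[OF assms(2)] D(1) assms(3) by blast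
qed

lemma cut_mono_iff:
  assumes "b \<in> carrier B" "c \<in> carrier B"
  shows "cut b \<subseteq> cut c \<longleftrightarrow> b \<sqsubseteq> c"
proof
  assume "cut b \<subseteq> cut c"
  then show "b \<sqsubseteq> c"
    using assms by (auto simp: cut_def intro!: le_if_dense[of b c])
next
  assume "b \<sqsubseteq> c"
  then show "cut b \<subseteq> cut c"
    using assms le_trans[of _ b c] by (auto simp: cut_def emb_closed)
qed

lemma Upper_cut:
  assumes "b \<in> carrier B"
  shows "Upper Q (cut b) = {q \<in> carrier Q. b \<sqsubseteq> \<phi> q}"
proof -
  have "Upper Q (cut b) = {q \<in> carrier Q. cut b \<subseteq> cut (\<phi> q)}"
    by (auto simp: Upper_def cut_def emb_le_iff)
  also have "\<dots> = {q \<in> carrier Q. b \<sqsubseteq> \<phi> q}"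
    using cut_mono_iff[OF assms emb_closed] by (auto simp del: subset_iff)
  finally show ?thesis .
qed

text \<open>Let p be below all upper bounds of \<open>cut b\<close>. If q in \<open>Q\<close> lies
  below p and outside b, its complement is such an upper bound, so p is disjoint from q, which is
  below p; hence q is zero. By density the part of p outside b is zero.\<close>

lemma Lower_Upper_cut:
  assumes "b \<in> carrier B"
  shows "Lower Q (Upper Q (cut b)) = cut b"
proof
  show "cut b \<subseteq> Lower Q (Upper Q (cut b))"
    by (auto simp: Lower_def Upper_def cut_def)
  show "Lower Q (Upper Q (cut b)) \<subseteq> cut b"
  proof
    fix p assume p: "p \<in> Lower Q (Upper Q (cut b))"
    then have pQ: "p \<in> carrier Q"
      by (simp add: Lower_def)
    note p_closed = emb_closed[OF pQ]
    have "\<phi> p \<sqinter> complement B b \<sqsubseteq> \<bottom>"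
    proof (rule le_if_dense)
      fix q assume q: "q \<in> carrier Q" "\<phi> q \<sqsubseteq> \<phi> p \<sqinter> complement B b"
      note q_closed = emb_closed[OF q(1)]
      have le: "\<phi> q \<sqsubseteq> \<phi> p" "\<phi> q \<sqsubseteq> complement B b"
        using q(2) p_closed q_closed assms by (simp_all add: le_meet_iff)
      obtain r where r: "r \<in> carrier Q" "\<phi> r = complement B (\<phi> q)"
        using emb_complement[OF q(1)] by blast
      have "b \<sqsubseteq> \<phi> r"
        using le(2) assms q_closed r(2) by (simp add: le_complement_iff meet_comm)
      then have "\<phi> p \<sqsubseteq> complement B (\<phi> q)"
        using p r pQ assms by (auto simp: Upper_cut Lower_def emb_le_iff)
      then have "\<phi> q \<sqinter> \<phi> p = \<bottom>"
        using q_closed p_closed by (simp add: le_complement_iff)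
      then show "\<phi> q \<sqsubseteq> \<bottom>"
        using le(1) q_closed p_closed by (simp add: meet_bottom_iff)
    qed (use p_closed assms in simp_all)
    then have "\<phi> p \<sqinter> complement B b = \<bottom>"
      using p_closed assms by (simp add: le_bottom_iff)
    then have "\<phi> p \<sqsubseteq> b"
      using p_closed assms by (simp add: le_iff_meet_complement)
    then show "p \<in> cut b"
      using pQ by (simp add: cut_def)
  qed
qed

lemma cut_closed: "b \<in> carrier B \<Longrightarrow> cut b \<in> carrier (completion Q)"
  by (simp add: completion_def Lower_Upper_cut) (auto simp: cut_def)

text \<open>A cut is recovered from its upper bounds, so inclusions into an arbitrary cut can be
  tested in \<open>B\<close>. This is the tool for showing that hulls of unions are large
  enough.\<close>

lemma cut_subset_iff:
  assumes "b \<in> carrier B" "X \<in> carrier (completion Q)"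
  shows "cut b \<subseteq> X \<longleftrightarrow> (\<forall>q \<in> Upper Q X. b \<sqsubseteq> \<phi> q)"
proof
  assume "cut b \<subseteq> X"
  then show "\<forall>q \<in> Upper Q X. b \<sqsubseteq> \<phi> q"
    using Upper_antimono[of "cut b" X Q] Upper_cut[OF assms(1)] by blast
next
  assume "\<forall>q \<in> Upper Q X. b \<sqsubseteq> \<phi> q"
  then have "Upper Q X \<subseteq> Upper Q (cut b)"
    using Upper_cut[OF assms(1)] Upper_closed[of Q X] by blast
  then have "Lower Q (Upper Q (cut b)) \<subseteq> Lower Q (Upper Q X)"
    by (rule Lower_antimono)
  then show "cut b \<subseteq> X"
    using assms by (simp add: Lower_Upper_cut completion_def)
qed

end

section \<open>Lattice operations on families of cuts\<close>

text \<open>The closure operator whose closed sets are the cuts: suprema in the completion are hulls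
  of unions, whereas binary meets are plain intersections.\<close>

definition cut_hull :: "('a, 'm) gorder_scheme \<Rightarrow> 'a set \<Rightarrow> 'a set" where
  "cut_hull L X = Lower L (Upper L X)"

lemma carrier_completion: "X \<in> carrier (completion L) \<longleftrightarrow> X \<subseteq> carrier L \<and> cut_hull L X = X"
  by (simp add: completion_def cut_hull_def)

lemma completion_subset: "X \<in> carrier (completion L) \<Longrightarrow> X \<subseteq> carrier L"
  by (simp add: carrier_completion)

lemma le_completion [simp]: "X \<sqsubseteq>\<^bsub>completion L\<^esub> Y \<longleftrightarrow> X \<subseteq> Y"
  by (simp add: completion_def)

lemma cut_hull_extensive: "X \<subseteq> carrier L \<Longrightarrow> X \<subseteq> cut_hull L X"
  by (auto simp: cut_hull_def Lower_def Upper_def)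

lemma cut_hull_mono: "X \<subseteq> Y \<Longrightarrow> cut_hull L X \<subseteq> cut_hull L Y"
  unfolding cut_hull_def by (intro Lower_antimono Upper_antimono)

lemma cut_hull_minimal: "\<lbrakk>X \<subseteq> Y; Y \<in> carrier (completion L)\<rbrakk> \<Longrightarrow> cut_hull L X \<subseteq> Y"
  using cut_hull_mono[of X Y L] by (simp add: carrier_completion)

lemma cut_hull_closed: "X \<subseteq> carrier L \<Longrightarrow> cut_hull L X \<in> carrier (completion L)"
  by (auto simp: carrier_completion cut_hull_def Lower_def Upper_def)

lemma completion_Int_closed:
  assumes "X \<in> carrier (completion L)" "Y \<in> carrier (completion L)"
  shows "X \<inter> Y \<in> carrier (completion L)"
  using assms cut_hull_mono[of "X \<inter> Y" X L] cut_hull_mono[of "X \<inter> Y" Y L]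
    cut_hull_extensive[of "X \<inter> Y" L] by (auto simp: carrier_completion)

text \<open>A supremum depends on the carrier. It is computed here for a subfamily \<open>T\<close>
  that contains the hull, where it agrees with the supremum in the whole completion.\<close>

lemma completion_sup:
  assumes "T \<subseteq> carrier (completion L)" "A \<subseteq> T" "cut_hull L (\<Union>A) \<in> T"
  shows "\<Squnion>\<^bsub>(completion L)\<lparr>carrier := T\<rparr>\<^esub>A = cut_hull L (\<Union>A)"
proof -
  have "\<Union>A \<subseteq> carrier L"
    using assms(1,2) completion_subset by blast
  then have "X \<subseteq> cut_hull L (\<Union>A)" if "X \<in> A" for X
    using that cut_hull_extensive[of "\<Union>A" L] by blast
  moreover have "cut_hull L (\<Union>A) \<subseteq> Y" if "\<forall>X. X \<in> A \<and> X \<in> T \<longrightarrow> X \<subseteq> Y" "Y \<in> T" for Y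
    by (rule cut_hull_minimal) (use that assms in auto)
  ultimately show ?thesis
    unfolding sup_def using assms(3)
    by (intro some_least_inclusion) (simp_all add: least_def Upper_def)
qed

lemma completion_join:
  assumes "T \<subseteq> carrier (completion L)" "X \<in> T" "Y \<in> T" "cut_hull L (X \<union> Y) \<in> T"
  shows "X \<squnion>\<^bsub>(completion L)\<lparr>carrier := T\<rparr>\<^esub> Y = cut_hull L (X \<union> Y)"
  using completion_sup[of T L "{X, Y}"] assms by (simp add: join_def)

lemma completion_meet:
  assumes "X \<in> T" "Y \<in> T" "X \<inter> Y \<in> T"
  shows "X \<sqinter>\<^bsub>(completion L)\<lparr>carrier := T\<rparr>\<^esub> Y = X \<inter> Y"
  unfolding meet_def inf_def using assms
  by (intro some_greatest_inclusion) (auto simp: greatest_def Lower_def)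

section \<open>Complements in the completion\<close>

context sigma_dense_embedding
begin

lemma cut_bottom_least:
  assumes "X \<in> carrier (completion Q)"
  shows "cut \<bottom> \<subseteq> X"
proof -
  have "\<bottom> \<sqsubseteq> \<phi> q" if "q \<in> Upper Q X" for q
    using that emb_closed[of q] by (simp add: bottom_lower Upper_def)
  then show ?thesis
    using assms by (simp add: cut_subset_iff)
qed

lemma cut_top: "cut \<top> = carrier Q"
  using emb_closed by (auto simp: cut_def top_higher)

lemma cut_meet: "\<lbrakk>b \<in> carrier B; c \<in> carrier B\<rbrakk> \<Longrightarrow> cut (b \<sqinter> c) = cut b \<inter> cut c"
  using emb_closed by (auto simp: cut_def le_meet_iff)

text \<open>An upper bound in \<open>Q\<close> of the hull bounds b and c, hence their join;
  \<open>cut_subset_iff\<close> turns this into the harder inclusion.\<close>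

lemma cut_join:
  assumes "b \<in> carrier B" "c \<in> carrier B"
  shows "cut (b \<squnion> c) = cut_hull Q (cut b \<union> cut c)"
proof
  show "cut_hull Q (cut b \<union> cut c) \<subseteq> cut (b \<squnion> c)"
    using assms by (intro cut_hull_minimal) (simp_all add: cut_closed cut_mono_iff join_left join_right)
  have sub: "cut b \<union> cut c \<subseteq> carrier Q"
    by (auto simp: cut_def)
  note H = cut_hull_closed[OF sub]
  have "cut b \<subseteq> cut_hull Q (cut b \<union> cut c)" "cut c \<subseteq> cut_hull Q (cut b \<union> cut c)"
    using cut_hull_extensive[OF sub] by auto
  then have "b \<squnion> c \<sqsubseteq> \<phi> q" if "q \<in> Upper Q (cut_hull Q (cut b \<union> cut c))" for q
    using that assms H emb_closed[of q] by (simp add: cut_subset_iff join_le_iff Upper_def)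
  then show "cut (b \<squnion> c) \<subseteq> cut_hull Q (cut b \<union> cut c)"
    using assms H by (simp add: cut_subset_iff)
qed

text \<open>Disjointness is measured in \<open>B\<close>, because no meets are assumed in
  \<open>Q\<close>. This set turns out to be the complement of a cut.\<close>

definition pseudocomplement :: "'q set \<Rightarrow> 'q set" where
  "pseudocomplement X = {q \<in> carrier Q. \<forall>p \<in> X. \<phi> p \<sqinter> \<phi> q = \<bottom>}"

text \<open>For p in \<open>X\<close> the complement of p is an upper bound of the pseudocomplement.
  An element of the hull lies below it and is therefore disjoint from p.\<close>

lemma pseudocomplement_closed:
  assumes "X \<subseteq> carrier Q"
  shows "pseudocomplement X \<in> carrier (completion Q)"
proof -
  have sub: "pseudocomplement X \<subseteq> carrier Q"
    by (auto simp: pseudocomplement_def)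
  have "q \<in> pseudocomplement X" if q: "q \<in> cut_hull Q (pseudocomplement X)" for q
  proof -
    have qQ: "q \<in> carrier Q"
      using q by (simp add: cut_hull_def Lower_def)
    have "\<phi> p \<sqinter> \<phi> q = \<bottom>" if p: "p \<in> X" for p
    proof -
      have pQ: "p \<in> carrier Q"
        using p assms by blast
      then obtain r where r: "r \<in> carrier Q" "\<phi> r = complement B (\<phi> p)"
        using emb_complement by blast
      have "r \<in> Upper Q (pseudocomplement X)"
        using r p pQ by (auto simp: Upper_def pseudocomplement_def emb_le_iff emb_closed le_complement_iff)
      then have "q \<sqsubseteq>\<^bsub>Q\<^esub> r"
        using q r(1) by (auto simp: cut_hull_def Lower_def)
      then show ?thesis
        using qQ pQ r by (simp add: emb_le_iff emb_closed le_complement_iff)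
    qed
    then show ?thesis
      using qQ by (simp add: pseudocomplement_def)
  qed
  then show ?thesis
    using sub cut_hull_extensive[OF sub] by (auto simp: carrier_completion)
qed

text \<open>Being disjoint from all of \<open>cut b\<close> means that \<open>cut b\<close> lies
  inside the cut of the complement of \<open>\<phi> q\<close>; by \<open>cut_mono_iff\<close> this
  is disjointness from b itself.\<close>

lemma pseudocomplement_cut:
  assumes "b \<in> carrier B"
  shows "pseudocomplement (cut b) = cut (complement B b)"
proof -
  have "(\<forall>p \<in> cut b. \<phi> p \<sqinter> \<phi> q = \<bottom>) \<longleftrightarrow> \<phi> q \<sqsubseteq> complement B b"
    if "q \<in> carrier Q" for q
  proof -
    have "(\<forall>p \<in> cut b. \<phi> p \<sqinter> \<phi> q = \<bottom>) \<longleftrightarrow> cut b \<subseteq> cut (complement B (\<phi> q))"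
      using that by (auto simp: cut_def emb_closed le_complement_iff meet_comm[of B "\<phi> q"])
    also have "\<dots> \<longleftrightarrow> \<phi> q \<sqsubseteq> complement B b"
      using that assms
      by (simp add: cut_mono_iff emb_closed le_complement_iff meet_comm[of B "\<phi> q"])
    finally show ?thesis .
  qed
  then show ?thesis
    by (auto simp: pseudocomplement_def cut_def[of "complement B b"])
qed

text \<open>Cuts are closed downwards, so for p in \<open>X\<close> and q in \<open>Y\<close>
  everything of \<open>Q\<close> below both lies in the intersection and is zero; density makes p
  and q disjoint. This is one half of the uniqueness of complements.\<close>

lemma disjoint_subset_pseudocomplement:
  assumes X: "X \<in> carrier (completion Q)" and Y: "Y \<in> carrier (completion Q)"
    and "X \<inter> Y \<subseteq> cut \<bottom>"
  shows "Y \<subseteq> pseudocomplement X"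
proof
  fix q assume q: "q \<in> Y"
  then have qQ: "q \<in> carrier Q"
    using Y by (auto simp: carrier_completion)
  have principal: "cut (\<phi> r) \<subseteq> Z" if "r \<in> Z" "Z \<in> carrier (completion Q)" for r Z
    using that completion_subset[OF that(2)]
    by (subst cut_subset_iff) (auto simp: Upper_def emb_le_iff emb_closed)
  have "\<phi> p \<sqinter> \<phi> q = \<bottom>" if p: "p \<in> X" for p
  proof -
    have pQ: "p \<in> carrier Q"
      using p X by (auto simp: carrier_completion)
    have "cut (\<phi> p \<sqinter> \<phi> q) \<subseteq> cut \<bottom>"
      using principal[OF p X] principal[OF q Y] assms(3) pQ qQ
      by (auto simp: cut_meet emb_closed)
    then show ?thesis
      using pQ qQ by (simp add: cut_mono_iff emb_closed le_bottom_iff)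
  qed
  then show "q \<in> pseudocomplement X"
    using qQ by (simp add: pseudocomplement_def)
qed

text \<open>The other half of uniqueness. To place q in \<open>Y\<close> it suffices that q is below
  each upper bound u of \<open>Y\<close>.\<close>

lemma pseudocomplement_subset_if_hull_Un:
  assumes X: "X \<in> carrier (completion Q)" and Y: "Y \<in> carrier (completion Q)"
    and top: "cut_hull Q (X \<union> Y) = carrier Q"
  shows "pseudocomplement X \<subseteq> Y"
proof
  fix q assume q: "q \<in> pseudocomplement X"
  then have qQ: "q \<in> carrier Q"
    by (simp add: pseudocomplement_def)
  have "\<phi> q \<sqsubseteq> \<phi> u" if u: "u \<in> Upper Q Y" for u
  proof -
    have uQ: "u \<in> carrier Q"
      using u by (simp add: Upper_def)
    note closed = emb_closed[OF qQ] emb_closed[OF uQ]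
    \<comment> \<open>The implication from q to u. Its cut contains \<open>X\<close>, which is
      disjoint from q, and \<open>Y\<close>, which is below u; so it contains the hull, and the
      implication is the unit.\<close>
    let ?c = "complement B (\<phi> q) \<squnion> \<phi> u"
    have "\<phi> r \<sqsubseteq> ?c" if r: "r \<in> X \<union> Y" for r
    proof -
      have rQ: "r \<in> carrier Q"
        using r X Y by (auto simp: carrier_completion)
      have "\<phi> r \<sqsubseteq> complement B (\<phi> q) \<or> \<phi> r \<sqsubseteq> \<phi> u"
        using r q u rQ uQ closed
        by (auto simp: pseudocomplement_def Upper_def emb_le_iff emb_closed le_complement_iff
            meet_comm[of B "\<phi> q"])
      then show ?thesis
        using le_trans[OF _ join_left[of "complement B (\<phi> q)" "\<phi> u"], of "\<phi> r"]
          le_trans[OF _ join_right[of "complement B (\<phi> q)" "\<phi> u"], of "\<phi> r"]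
          closed emb_closed[OF rQ] by auto
    qed
    then have "X \<union> Y \<subseteq> cut ?c"
      using X Y by (auto simp: cut_def carrier_completion)
    then have "cut \<top> \<subseteq> cut ?c"
      using cut_hull_minimal[of "X \<union> Y" "cut ?c" Q] top closed by (simp add: cut_closed cut_top)
    then have "?c = \<top>"
      using closed by (simp add: cut_mono_iff top_le_iff)
    then have "complement B (complement B (\<phi> q)) \<sqsubseteq> \<phi> u"
      using closed by (simp add: complement_le_iff)
    then show ?thesis
      using closed by (simp add: complement_complement)
  qed
  then have "cut (\<phi> q) \<subseteq> Y"
    using Y qQ by (simp add: cut_subset_iff emb_closed)
  then show "q \<in> Y"
    using qQ by (auto simp: cut_def emb_closed)
qed

text \<open>If u bounds both sets, the complement of u is disjoint from \<open>X\<close>, hence in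
  the pseudocomplement, hence below u. This forces u to be the unit.\<close>

lemma hull_Un_pseudocomplement:
  assumes X: "X \<in> carrier (completion Q)"
  shows "cut_hull Q (X \<union> pseudocomplement X) = carrier Q"
proof -
  have XQ: "X \<subseteq> carrier Q"
    using X by (simp add: carrier_completion)
  have sub: "X \<union> pseudocomplement X \<subseteq> carrier Q"
    using XQ by (auto simp: pseudocomplement_def)
  have "\<top> \<sqsubseteq> \<phi> u" if u: "u \<in> Upper Q (cut_hull Q (X \<union> pseudocomplement X))" for u
  proof -
    have uQ: "u \<in> carrier Q"
      using u by (simp add: Upper_def)
    note u_closed = emb_closed[OF uQ]
    have up: "\<phi> p \<sqsubseteq> \<phi> u" if "p \<in> X \<union> pseudocomplement X" for p
      using that u sub uQ cut_hull_extensive[OF sub] by (auto simp: Upper_def emb_le_iff subset_iff)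
    obtain v where v: "v \<in> carrier Q" "\<phi> v = complement B (\<phi> u)"
      using emb_complement[OF uQ] by blast
    have "\<phi> p \<sqinter> \<phi> v = \<bottom>" if "p \<in> X" for p
      using up[of p] that XQ v u_closed emb_closed[of p] by (auto simp: le_iff_meet_complement)
    then have "v \<in> pseudocomplement X"
      using v by (simp add: pseudocomplement_def)
    then have "\<phi> v \<sqsubseteq> \<phi> u"
      using up by blast
    then have "\<phi> u \<squnion> \<phi> u = \<top>"
      using v uQ by (simp add: complement_le_iff emb_closed)
    then show ?thesis
      using u_closed join_le[of "\<phi> u" "\<phi> u" "\<phi> u"] by simp
  qed
  then have "cut \<top> \<subseteq> cut_hull Q (X \<union> pseudocomplement X)"
    using cut_hull_closed[OF sub] by (simp add: cut_subset_iff)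
  then show ?thesis
    by (auto simp: cut_top cut_hull_def Lower_def)
qed

lemma Int_pseudocomplement: "X \<subseteq> carrier Q \<Longrightarrow> X \<inter> pseudocomplement X \<subseteq> cut \<bottom>"
proof
  fix q assume "X \<subseteq> carrier Q" "q \<in> X \<inter> pseudocomplement X"
  then have "q \<in> carrier Q" "\<phi> q \<sqinter> \<phi> q = \<bottom>"
    by (auto simp: pseudocomplement_def)
  then show "q \<in> cut \<bottom>"
    using meet_le[of "\<phi> q" "\<phi> q" "\<phi> q"] emb_closed[of q] by (simp add: cut_def)
qed

section \<open>Subfamilies of the completion as algebras\<close>

context
  fixes T :: "'q set set"
  assumes cuts: "cut ` carrier B \<subseteq> T" and completion: "T \<subseteq> carrier (completion Q)"
    and Int_closed: "\<lbrakk>X \<in> T; Y \<in> T\<rbrakk> \<Longrightarrow> X \<inter> Y \<in> T"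
    and hull_closed: "\<lbrakk>X \<in> T; Y \<in> T\<rbrakk> \<Longrightarrow> cut_hull Q (X \<union> Y) \<in> T"
begin

text \<open>Used with three families for \<open>T\<close>: all cuts, the sigma-completion, and the
  image of \<open>cut\<close>.\<close>

abbreviation (input) suborder where "suborder \<equiv> (completion Q)\<lparr>carrier := T\<rparr>"

lemma suborder_bottom: "\<bottom>\<^bsub>suborder\<^esub> = cut \<bottom>"
proof -
  have "cut \<bottom> \<subseteq> X" if "X \<in> T" for X
    using that completion cut_bottom_least by blast
  then show ?thesis
    unfolding bottom_def[of suborder] using cuts
    by (intro some_least_inclusion) (auto simp: least_def)
qed

lemma suborder_top: "\<top>\<^bsub>suborder\<^esub> = cut \<top>"
proof -
  have "X \<subseteq> cut \<top>" if "X \<in> T" for X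
    using that completion completion_subset[of X Q] unfolding cut_top by blast
  then show ?thesis
    unfolding top_def[of suborder] using cuts
    by (intro some_greatest_inclusion) (auto simp: greatest_def)
qed

text \<open>The pseudocomplement is required to be in \<open>T\<close> for this one \<open>X\<close>
  only, so the lemma applies before \<open>T\<close> is known to be closed under
  complements.\<close>

lemma suborder_complement:
  assumes "X \<in> T" "pseudocomplement X \<in> T"
  shows "complement suborder X = pseudocomplement X"
proof -
  have iff: "X \<squnion>\<^bsub>suborder\<^esub> Y = \<top>\<^bsub>suborder\<^esub> \<and> X \<sqinter>\<^bsub>suborder\<^esub> Y = \<bottom>\<^bsub>suborder\<^esub> \<longleftrightarrow>
      cut_hull Q (X \<union> Y) = carrier Q \<and> X \<inter> Y \<subseteq> cut \<bottom>" if "Y \<in> T" for Y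
    using that assms(1) completion Int_closed[of X Y] hull_closed[of X Y] cut_bottom_least[of "X \<inter> Y"]
    by (auto simp: completion_join completion_meet suborder_bottom suborder_top cut_top)
  have X: "X \<in> carrier (completion Q)"
    using assms(1) completion by blast
  show ?thesis
    unfolding complement_def
  proof (rule the_equality)
    show "pseudocomplement X \<in> carrier suborder \<and>
        X \<squnion>\<^bsub>suborder\<^esub> pseudocomplement X = \<top>\<^bsub>suborder\<^esub> \<and>
        X \<sqinter>\<^bsub>suborder\<^esub> pseudocomplement X = \<bottom>\<^bsub>suborder\<^esub>"
      using iff[OF assms(2)] assms(2) X hull_Un_pseudocomplement Int_pseudocomplement
      by (simp add: carrier_completion)
  next
    fix Y assume "Y \<in> carrier suborder \<and> X \<squnion>\<^bsub>suborder\<^esub> Y = \<top>\<^bsub>suborder\<^esub> \<and>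
        X \<sqinter>\<^bsub>suborder\<^esub> Y = \<bottom>\<^bsub>suborder\<^esub>"
    then have "Y \<in> T" "cut_hull Q (X \<union> Y) = carrier Q" "X \<inter> Y \<subseteq> cut \<bottom>"
      using iff by auto
    moreover from this completion have "Y \<in> carrier (completion Q)"
      by blast
    ultimately show "Y = pseudocomplement X"
      using X disjoint_subset_pseudocomplement pseudocomplement_subset_if_hull_Un by blast
  qed
qed

lemma suborder_cut_ops:
  assumes "b \<in> carrier B" "c \<in> carrier B"
  shows "cut b \<squnion>\<^bsub>suborder\<^esub> cut c = cut (b \<squnion> c)"
    and "cut b \<sqinter>\<^bsub>suborder\<^esub> cut c = cut (b \<sqinter> c)"
    and "complement suborder (cut b) = cut (complement B b)"
proof -
  have cut: "cut a \<in> T" if "a \<in> carrier B" for a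
    using cuts that by blast
  show "cut b \<squnion>\<^bsub>suborder\<^esub> cut c = cut (b \<squnion> c)"
    using assms completion by (simp add: completion_join cut hull_closed cut_join)
  show "cut b \<sqinter>\<^bsub>suborder\<^esub> cut c = cut (b \<sqinter> c)"
    using assms by (simp add: completion_meet cut Int_closed cut_meet)
  show "complement suborder (cut b) = cut (complement B b)"
    using assms by (simp add: suborder_complement cut pseudocomplement_cut)
qed

end

end

section \<open>The embedding into the sigma-completion\<close>

lemma completion_carrier_update: "(completion L)\<lparr>carrier := carrier (completion L)\<rparr> = completion L"
  by simp

lemma sigma_completion_update: "(sigma_completion L)\<lparr>carrier := S\<rparr> = (completion L)\<lparr>carrier := S\<rparr>"
  by (simp add: sigma_completion_def)

context sigma_dense_embedding
begin

text \<open>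
  Without this, the intersection defining the \<open>\<sigma>\<close>-completion could be over an empty family.
\<close>

lemma sigma_subalgebra_completion: "sigma_subalgebra (carrier (completion Q)) (completion Q)"
proof -
  let ?T = "carrier (completion Q)"
  have cuts: "cut ` carrier B \<subseteq> ?T"
    using cut_closed by blast
  have hull: "cut_hull Q (\<Union>A) \<in> ?T" if "A \<subseteq> ?T" for A
    using that completion_subset by (intro cut_hull_closed) blast
  have hull_Un: "cut_hull Q (X \<union> Y) \<in> ?T" if "X \<in> ?T" "Y \<in> ?T" for X Y
    using that hull[of "{X, Y}"] by simp
  have "\<bottom>\<^bsub>completion Q\<^esub> = cut \<bottom>" "\<top>\<^bsub>completion Q\<^esub> = cut \<top>"
    using suborder_bottom[OF cuts _ completion_Int_closed hull_Un]
      suborder_top[OF cuts _ completion_Int_closed hull_Un]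
    by (simp_all add: completion_carrier_update)
  moreover have "complement (completion Q) X \<in> ?T" if "X \<in> ?T" for X
    using suborder_complement[OF cuts _ completion_Int_closed hull_Un that]
      pseudocomplement_closed[OF completion_subset[OF that]]
    by (simp add: completion_carrier_update)
  ultimately show ?thesis
    using hull hull_Un cuts
    by (auto simp: sigma_subalgebra_def boolean_subalgebra_def completion_Int_closed
        completion_join[of ?T Q, unfolded completion_carrier_update]
        completion_meet[of _ ?T _ Q, unfolded completion_carrier_update]
        completion_sup[of ?T Q, unfolded completion_carrier_update])
qed

lemma cut_in_sigma_subalgebra:
  assumes S: "sigma_subalgebra S (completion Q)" and "principal_cut Q ` carrier Q \<subseteq> S"
    and b: "b \<in> carrier B"
  shows "cut b \<in> S"
proof -
  obtain D where D: "D \<subseteq> carrier Q" "countable D" "least B b (Upper B (\<phi> ` D))"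
    using sigma_dense[OF b] by blast
  have lub: "b \<sqsubseteq> c \<longleftrightarrow> (\<forall>q \<in> D. \<phi> q \<sqsubseteq> c)" if "c \<in> carrier B" for c
    using D(1,3) b that by (simp add: least_Upper_image_iff)
  let ?A = "(\<lambda>q. cut (\<phi> q)) ` D"
  have "?A = principal_cut Q ` D"
    using D(1) by (intro image_cong) (auto simp: principal_cut_eq)
  moreover have "principal_cut Q ` D \<subseteq> S"
    using D(1) assms(2) by blast
  ultimately have "?A \<subseteq> S"
    by (simp only:)
  then have in_S: "\<Squnion>\<^bsub>completion Q\<^esub>?A \<in> S"
    using S D(2) by (simp add: sigma_subalgebra_def)
  have "\<Union>?A \<subseteq> carrier Q"
    by (auto simp: cut_def)
  note hull_closed = cut_hull_closed[OF this] and ext = cut_hull_extensive[OF this]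
  have A_completion: "?A \<subseteq> carrier (completion Q)"
    using D(1) by (auto simp: cut_closed emb_closed subset_iff)
  have "\<Squnion>\<^bsub>completion Q\<^esub>?A = cut_hull Q (\<Union>?A)"
    using completion_sup[OF subset_refl A_completion hull_closed]
    by (simp only: completion_carrier_update)
  moreover have "cut_hull Q (\<Union>?A) = cut b"
  proof
    have "cut (\<phi> q) \<subseteq> cut b" if "q \<in> D" for q
      using subsetD[OF D(1) that] that b lub[OF b] le_refl[OF b]
      by (simp add: cut_mono_iff emb_closed)
    then show "cut_hull Q (\<Union>?A) \<subseteq> cut b"
      using b by (intro cut_hull_minimal) (auto simp: cut_closed)
    have "b \<sqsubseteq> \<phi> u" if u: "u \<in> Upper Q (cut_hull Q (\<Union>?A))" for u
    proof -
      have uQ: "u \<in> carrier Q"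
        using u by (simp add: Upper_def)
      have "\<phi> q \<sqsubseteq> \<phi> u" if "q \<in> D" for q
      proof -
        have q: "q \<in> carrier Q" "cut (\<phi> q) \<subseteq> cut_hull Q (\<Union>?A)"
          using that D(1) ext by auto
        then show ?thesis
          using u hull_closed by (simp add: cut_subset_iff emb_closed)
      qed
      then show ?thesis
        using lub uQ by (simp add: emb_closed)
    qed
    then show "cut b \<subseteq> cut_hull Q (\<Union>?A)"
      using b hull_closed by (simp add: cut_subset_iff)
  qed
  ultimately show ?thesis
    using in_S by simp
qed

theorem isomorphic_subalgebra_sigma_completion:
  "\<exists>S. boolean_subalgebra S (sigma_completion Q) \<and>
    boolean_isomorphic B ((sigma_completion Q)\<lparr>carrier := S\<rparr>)"
proof (intro exI conjI)
  let ?S = "cut ` carrier B" and ?T = "carrier (sigma_completion Q)"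
  have carrier_sigma: "?T =
      \<Inter>{S. sigma_subalgebra S (completion Q) \<and> principal_cut Q ` carrier Q \<subseteq> S}"
    by (simp add: sigma_completion_def)
  have S_T: "?S \<subseteq> ?T"
    unfolding carrier_sigma using cut_in_sigma_subalgebra by blast
  have "principal_cut Q ` carrier Q \<subseteq> carrier (completion Q)"
    using cut_closed emb_closed by (auto simp: principal_cut_eq)
  then have T_completion: "?T \<subseteq> carrier (completion Q)"
    unfolding carrier_sigma using sigma_subalgebra_completion by blast
  \<comment> \<open>\<open>?T\<close> is an intersection of sigma-subalgebras. Intersection and hull
    of union are operations of the completion, so every member of that intersection is closed under
    them.\<close>
  have T_ops: "X \<inter> Y \<in> ?T \<and> cut_hull Q (X \<union> Y) \<in> ?T" if "X \<in> ?T" "Y \<in> ?T" for X Y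
  proof -
    have XY: "X \<in> carrier (completion Q)" "Y \<in> carrier (completion Q)"
      using that T_completion by auto
    have "X \<union> Y \<subseteq> carrier Q"
      using XY completion_subset by blast
    note hull = cut_hull_closed[OF this]
    have "X \<inter> Y = X \<sqinter>\<^bsub>completion Q\<^esub> Y"
      using completion_meet[of X "carrier (completion Q)" Y Q] XY
      by (simp add: completion_carrier_update completion_Int_closed)
    moreover have "cut_hull Q (X \<union> Y) = X \<squnion>\<^bsub>completion Q\<^esub> Y"
      using completion_join[of "carrier (completion Q)" Q X Y] XY hull
      by (simp add: completion_carrier_update)
    ultimately show ?thesis
      using that unfolding carrier_sigma
      by (auto simp: sigma_subalgebra_def boolean_subalgebra_def)
  qed
  have sigma: "sigma_completion Q = (completion Q)\<lparr>carrier := ?T\<rparr>"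
    by (simp add: sigma_completion_def)
  \<comment> \<open>The context lemmas are used at \<open>?T\<close> to make the image a subalgebra,
    and below at \<open>?S\<close>, whose own operations the isomorphism refers to.\<close>
  note T = S_T T_completion conjunct1[OF T_ops] conjunct2[OF T_ops]
  show "boolean_subalgebra ?S (sigma_completion Q)"
    unfolding boolean_subalgebra_def
    using S_T suborder_bottom[OF T] suborder_top[OF T] suborder_cut_ops[OF T]
    by (auto simp flip: sigma)
  have S_ops: "X \<inter> Y \<in> ?S" "cut_hull Q (X \<union> Y) \<in> ?S" if "X \<in> ?S" "Y \<in> ?S" for X Y
    using that by (auto simp flip: cut_meet cut_join)
  have S_completion: "?S \<subseteq> carrier (completion Q)"
    using cut_closed by blast
  note S = subset_refl S_completion S_ops
  have "inj_on cut (carrier B)"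
  proof (rule inj_onI)
    fix b c assume "b \<in> carrier B" "c \<in> carrier B" "cut b = cut c"
    then show "b = c"
      using cut_mono_iff[of b c] cut_mono_iff[of c b] by (intro le_antisym) auto
  qed
  then have "boolean_iso B ((completion Q)\<lparr>carrier := ?S\<rparr>) cut"
    unfolding boolean_iso_def
    using suborder_bottom[OF S] suborder_top[OF S] suborder_cut_ops[OF S]
    by (auto simp: bij_betw_def)
  then show "boolean_isomorphic B ((sigma_completion Q)\<lparr>carrier := ?S\<rparr>)"
    unfolding sigma_completion_update boolean_isomorphic_def by blast
qed

end

section \<open>Homomorphisms from free Boolean algebras\<close>

inductive free_extension ::
    "('a, 'm) gorder_scheme \<Rightarrow> 'k set \<Rightarrow> ('k \<Rightarrow> 'a) \<Rightarrow> 'k set set \<Rightarrow> 'a \<Rightarrow> bool"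
  for L K g where
  generator: "i \<in> K \<Longrightarrow> free_extension L K g {X \<in> Pow K. i \<in> X} (g i)"
| empty: "free_extension L K g {} \<bottom>\<^bsub>L\<^esub>"
| compl: "free_extension L K g a x \<Longrightarrow> free_extension L K g (Pow K - a) (complement L x)"
| union: "\<lbrakk>free_extension L K g a x; free_extension L K g b y\<rbrakk> \<Longrightarrow>
    free_extension L K g (a \<union> b) (x \<squnion>\<^bsub>L\<^esub> y)"

lemma free_extension_exists: "a \<in> clopen_sets K \<Longrightarrow> \<exists>x. free_extension L K g a x"
proof (induction rule: clopen_sets.induct)
  case (generator i)
  then show ?case
    using free_extension.generator by metis
next
  case empty
  then show ?case
    using free_extension.empty by metis
next
  case (compl a)
  then show ?case
    using free_extension.compl by metis
next
  case (union a b)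
  then show ?case
    using free_extension.union by metis
qed

context boolean_lattice
begin

lemma free_extension_closed:
  assumes "free_extension L K g a x" "g \<in> K \<rightarrow> carrier L"
  shows "x \<in> carrier L"
  using assms(1) by induction (use assms(2) in auto)

definition decides :: "'a \<Rightarrow> 'a \<Rightarrow> bool" where
  "decides z x \<longleftrightarrow> z \<sqsubseteq> x \<or> z \<sqsubseteq> complement L x"

text \<open>
  Once \<open>z\<close> decides the finitely many generators involved, \<open>{i \<in> K. z \<sqsubseteq> g i}\<close> is a point of the
  Cantor cube telling on which side of \<open>x\<close> the element \<open>z\<close> lies.  This replaces an ultrafilter in
  the proof that \<open>x\<close> is determined by \<open>a\<close>.
\<close>

lemma free_extension_decided:
  assumes "free_extension L K g a x" and g: "g \<in> K \<rightarrow> carrier L"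
  shows "\<exists>J \<subseteq> K. finite J \<and> (\<forall>z \<in> carrier L. (\<forall>i \<in> J. decides z (g i)) \<longrightarrow>
    (if {i \<in> K. z \<sqsubseteq> g i} \<in> a then z \<sqsubseteq> x else z \<sqsubseteq> complement L x))"
  using assms(1)
proof induction
  case (generator i)
  then show ?case
    by (intro exI[of _ "{i}"]) (auto simp: decides_def)
next
  case empty
  have "z \<sqsubseteq> complement L \<bottom>" if "z \<in> carrier L" for z
    using that by (simp add: le_complement_iff meet_bottom_iff le_bottom_iff)
  then show ?case
    by (intro exI[of _ "{}"]) auto
next
  case (compl a x)
  have "complement L (complement L x) = x"
    using compl.hyps g by (simp add: complement_complement free_extension_closed)
  moreover have "{i \<in> K. z \<sqsubseteq> g i} \<in> Pow K - a \<longleftrightarrow> {i \<in> K. z \<sqsubseteq> g i} \<notin> a" for z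
    by blast
  ultimately show ?case
    using compl.IH by (simp split: if_splits) metis
next
  case (union a x b y)
  have closed: "x \<in> carrier L" "y \<in> carrier L"
    using union.hyps g by (simp_all add: free_extension_closed)
  obtain J where J: "J \<subseteq> K" "finite J"
      "\<And>z. \<lbrakk>z \<in> carrier L; \<forall>i \<in> J. decides z (g i)\<rbrakk> \<Longrightarrow>
        if {i \<in> K. z \<sqsubseteq> g i} \<in> a then z \<sqsubseteq> x else z \<sqsubseteq> complement L x"
    using union.IH(1) by blast
  obtain J' where J': "J' \<subseteq> K" "finite J'"
      "\<And>z. \<lbrakk>z \<in> carrier L; \<forall>i \<in> J'. decides z (g i)\<rbrakk> \<Longrightarrow>
        if {i \<in> K. z \<sqsubseteq> g i} \<in> b then z \<sqsubseteq> y else z \<sqsubseteq> complement L y"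
    using union.IH(2) by blast
  have "if {i \<in> K. z \<sqsubseteq> g i} \<in> a \<union> b then z \<sqsubseteq> x \<squnion> y else z \<sqsubseteq> complement L (x \<squnion> y)"
    if z: "z \<in> carrier L" and dec: "\<forall>i \<in> J \<union> J'. decides z (g i)" for z
  proof -
    have xy: "if {i \<in> K. z \<sqsubseteq> g i} \<in> a then z \<sqsubseteq> x else z \<sqsubseteq> complement L x"
        "if {i \<in> K. z \<sqsubseteq> g i} \<in> b then z \<sqsubseteq> y else z \<sqsubseteq> complement L y"
      using J(3)[OF z] J'(3)[OF z] dec by simp_all
    have "z \<sqsubseteq> x \<squnion> y" if "z \<sqsubseteq> x \<or> z \<sqsubseteq> y"
      using that z closed le_trans[OF _ join_left[OF closed], of z]
        le_trans[OF _ join_right[OF closed], of z] by auto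
    moreover have "z \<sqsubseteq> complement L (x \<squnion> y)" if "z \<sqsubseteq> complement L x" "z \<sqsubseteq> complement L y"
    proof -
      have "z \<sqinter> x = \<bottom>" "z \<sqinter> y = \<bottom>"
        using that z closed by (simp_all add: le_complement_iff meet_comm[of L z])
      then have "z \<sqinter> (x \<squnion> y) = \<bottom>"
        using z closed join_le[of \<bottom> \<bottom> \<bottom>] by (simp add: meet_join_distrib le_bottom_iff)
      then show ?thesis
        using z closed by (simp add: le_complement_iff meet_comm[of L z])
    qed
    ultimately show ?thesis
      using xy by (auto split: if_splits)
  qed
  then show ?case
    using J(1,2) J'(1,2) by (intro exI[of _ "J \<union> J'"]) simp
qed

lemma exists_deciding_below:
  assumes "finite J" "g \<in> J \<rightarrow> carrier L" "w \<in> carrier L" "w \<noteq> \<bottom>"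
  shows "\<exists>z \<in> carrier L. z \<noteq> \<bottom> \<and> z \<sqsubseteq> w \<and> (\<forall>i \<in> J. decides z (g i))"
  using assms(1,2)
proof (induction J rule: finite_induct)
  case empty
  then show ?case
    using assms(3,4) by auto
next
  case (insert i J)
  have gi: "g i \<in> carrier L"
    using insert.prems by auto
  obtain z where z: "z \<in> carrier L" "z \<noteq> \<bottom>" "z \<sqsubseteq> w" "\<forall>i \<in> J. decides z (g i)"
    using insert by auto
  show ?case
  proof (cases "z \<sqinter> g i = \<bottom>")
    case True
    then have "z \<sqsubseteq> complement L (g i)"
      using z(1) gi by (simp add: le_complement_iff meet_comm[of L z])
    then show ?thesis
      using z by (auto simp: decides_def)
  next
    case False
    have below: "z \<sqinter> g i \<sqsubseteq> y" if "z \<sqsubseteq> y" "y \<in> carrier L" for y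
      using le_trans[OF meet_left that(1)] that(2) z(1) gi by simp
    have "decides (z \<sqinter> g i) (g j)" if "j \<in> J" for j
    proof -
      have "g j \<in> carrier L"
        using that insert.prems by auto
      then show ?thesis
        using bspec[OF z(4) that] below by (auto simp: decides_def)
    qed
    moreover have "decides (z \<sqinter> g i) (g i)"
      using z(1) gi by (simp add: decides_def meet_right)
    ultimately show ?thesis
      using False z gi below[OF z(3) assms(3)] by (intro bexI[of _ "z \<sqinter> g i"]) auto
  qed
qed

lemma free_extension_le:
  assumes x: "free_extension L K g a x" and y: "free_extension L K g a y"
    and g: "g \<in> K \<rightarrow> carrier L"
  shows "x \<sqsubseteq> y"
proof (rule ccontr)
  note closed = free_extension_closed[OF x g] free_extension_closed[OF y g]
  assume "\<not> x \<sqsubseteq> y"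
  then have "x \<sqinter> complement L y \<noteq> \<bottom>"
    using closed by (simp add: le_iff_meet_complement)
  obtain J where J: "J \<subseteq> K" "finite J"
      "\<And>z. \<lbrakk>z \<in> carrier L; \<forall>i \<in> J. decides z (g i)\<rbrakk> \<Longrightarrow>
        if {i \<in> K. z \<sqsubseteq> g i} \<in> a then z \<sqsubseteq> x else z \<sqsubseteq> complement L x"
    using free_extension_decided[OF x g] by blast
  obtain J' where J': "J' \<subseteq> K" "finite J'"
      "\<And>z. \<lbrakk>z \<in> carrier L; \<forall>i \<in> J'. decides z (g i)\<rbrakk> \<Longrightarrow>
        if {i \<in> K. z \<sqsubseteq> g i} \<in> a then z \<sqsubseteq> y else z \<sqsubseteq> complement L y"
    using free_extension_decided[OF y g] by blast
  have "g \<in> J \<union> J' \<rightarrow> carrier L"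
    using g J(1) J'(1) by auto
  then obtain z where z: "z \<in> carrier L" "z \<noteq> \<bottom>" "z \<sqsubseteq> x \<sqinter> complement L y"
      "\<forall>i \<in> J \<union> J'. decides z (g i)"
    using exists_deciding_below[of "J \<union> J'" g "x \<sqinter> complement L y"] J(2) J'(2) closed
      \<open>x \<sqinter> complement L y \<noteq> \<bottom>\<close> by auto
  have le: "z \<sqsubseteq> x" "z \<sqsubseteq> complement L y"
    using z(1,3) closed by (simp_all add: le_meet_iff)
  have "z \<sqsubseteq> complement L x \<or> z \<sqsubseteq> y"
    using J(3)[OF z(1)] J'(3)[OF z(1)] z(4) by (auto split: if_splits)
  then show False
    using z(1,2) le closed meet_complement meet_bottom_iff[of x "complement L x"]
      meet_bottom_iff[of y "complement L y"] by auto
qed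

lemma free_extension_unique:
  "\<lbrakk>free_extension L K g a x; free_extension L K g a y; g \<in> K \<rightarrow> carrier L\<rbrakk> \<Longrightarrow> x = y"
  by (intro le_antisym) (auto intro: free_extension_le free_extension_closed)

theorem free_algebra_universal:
  assumes "g \<in> K \<rightarrow> carrier L"
  shows "\<exists>\<phi>. (\<forall>a \<in> clopen_sets K. \<phi> a \<in> carrier L) \<and>
    (\<forall>i \<in> K. \<phi> {X \<in> Pow K. i \<in> X} = g i) \<and> \<phi> {} = \<bottom> \<and>
    (\<forall>a \<in> clopen_sets K. \<phi> (Pow K - a) = complement L (\<phi> a)) \<and>
    (\<forall>a \<in> clopen_sets K. \<forall>b \<in> clopen_sets K. \<phi> (a \<union> b) = \<phi> a \<squnion> \<phi> b)"
proof (intro exI conjI ballI)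
  define \<phi> where "\<phi> a = (SOME x. free_extension L K g a x)" for a
  have eqI: "\<phi> a = x" if "free_extension L K g a x" for a x
    unfolding \<phi>_def using that assms free_extension_unique by (intro some_equality) blast+
  have ext: "free_extension L K g a (\<phi> a)" if "a \<in> clopen_sets K" for a
    unfolding \<phi>_def using free_extension_exists[OF that] by (rule someI_ex)
  show "\<phi> a \<in> carrier L" if "a \<in> clopen_sets K" for a
    using ext[OF that] assms by (rule free_extension_closed)
  show "\<phi> {X \<in> Pow K. i \<in> X} = g i" if "i \<in> K" for i
    using that by (intro eqI free_extension.generator)
  show "\<phi> {} = \<bottom>"
    by (intro eqI free_extension.empty)
  show "\<phi> (Pow K - a) = complement L (\<phi> a)" if "a \<in> clopen_sets K" for a
    using that by (intro eqI free_extension.compl ext)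
  show "\<phi> (a \<union> b) = \<phi> a \<squnion> \<phi> b" if "a \<in> clopen_sets K" "b \<in> clopen_sets K" for a b
    using that by (intro eqI free_extension.union ext)
qed

end

section \<open>Quotients of free algebras\<close>

lemma clopen_sets_subset: "a \<in> clopen_sets K \<Longrightarrow> a \<subseteq> Pow K"
  by (induction rule: clopen_sets.induct) auto

lemma clopen_sets_Int:
  assumes "a \<in> clopen_sets K" "b \<in> clopen_sets K"
  shows "a \<inter> b \<in> clopen_sets K"
proof -
  have "a \<inter> b = Pow K - ((Pow K - a) \<union> (Pow K - b))"
    using assms clopen_sets_subset by blast
  then show ?thesis
    using assms by (simp only:) (intro clopen_sets.compl clopen_sets.union)
qed

lemma clopen_sets_Diff:
  assumes "a \<in> clopen_sets K" "b \<in> clopen_sets K"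
  shows "a - b \<in> clopen_sets K"
proof -
  have "a - b = a \<inter> (Pow K - b)"
    using assms clopen_sets_subset by blast
  then show ?thesis
    using assms by (simp only:) (intro clopen_sets.compl clopen_sets_Int)
qed

lemma free_algebra_simps [simp]:
  "carrier (free_algebra K) = clopen_sets K" "a \<sqsubseteq>\<^bsub>free_algebra K\<^esub> b \<longleftrightarrow> a \<subseteq> b"
  by (simp_all add: free_algebra_def)

lemma free_algebra_bottom: "\<bottom>\<^bsub>free_algebra K\<^esub> = {}"
  unfolding bottom_def
  by (intro some_least_inclusion) (simp_all add: least_def clopen_sets.empty)

lemma free_algebra_top: "\<top>\<^bsub>free_algebra K\<^esub> = Pow K"
  unfolding top_def using clopen_sets.compl[OF clopen_sets.empty, of K]
  by (intro some_greatest_inclusion) (simp_all add: greatest_def clopen_sets_subset)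

lemma free_algebra_join:
  "\<lbrakk>a \<in> clopen_sets K; b \<in> clopen_sets K\<rbrakk> \<Longrightarrow> a \<squnion>\<^bsub>free_algebra K\<^esub> b = a \<union> b"
  unfolding join_def sup_def
  by (intro some_least_inclusion) (auto simp: least_def Upper_def clopen_sets.union)

lemma free_algebra_meet:
  "\<lbrakk>a \<in> clopen_sets K; b \<in> clopen_sets K\<rbrakk> \<Longrightarrow> a \<sqinter>\<^bsub>free_algebra K\<^esub> b = a \<inter> b"
  unfolding meet_def inf_def
  by (intro some_greatest_inclusion) (auto simp: greatest_def Lower_def clopen_sets_Int)

lemma free_algebra_complement:
  assumes "a \<in> clopen_sets K"
  shows "complement (free_algebra K) a = Pow K - a"
proof -
  have "a \<squnion>\<^bsub>free_algebra K\<^esub> b = \<top>\<^bsub>free_algebra K\<^esub> \<and>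
      a \<sqinter>\<^bsub>free_algebra K\<^esub> b = \<bottom>\<^bsub>free_algebra K\<^esub> \<longleftrightarrow> b = Pow K - a" if b: "b \<in> clopen_sets K" for b
  proof -
    have "a \<union> b = Pow K \<and> a \<inter> b = {} \<longleftrightarrow> b = Pow K - a"
      using assms b clopen_sets_subset by blast
    then show ?thesis
      using assms b
      by (simp add: free_algebra_join free_algebra_meet free_algebra_top free_algebra_bottom)
  qed
  then show ?thesis
    unfolding complement_def free_algebra_simps using clopen_sets.compl[OF assms]
    by (intro the_equality) blast+
qed

lemma free_algebra_difference:
  assumes "a \<in> clopen_sets K" "b \<in> clopen_sets K"
  shows "difference (free_algebra K) a b = a - b"
  using assms clopen_sets_subset[of a K]
  by (auto simp: difference_def free_algebra_complement free_algebra_meet clopen_sets.compl)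

lemma (in boolean_lattice) quotient_sigma_dense_embedding:
  assumes g: "g \<in> K \<rightarrow> carrier L"
    and dense: "\<And>b. b \<in> carrier L \<Longrightarrow> \<exists>D \<subseteq> g ` K. countable D \<and> least L b (Upper L D)"
  shows "\<exists>I \<psi>. boolean_ideal I (free_algebra K) \<and>
    sigma_dense_embedding L (quotient_algebra (free_algebra K) I) \<psi>"
proof -
  let ?F = "free_algebra K"
  obtain \<phi> where \<phi>: "(\<forall>a \<in> clopen_sets K. \<phi> a \<in> carrier L) \<and>
      (\<forall>i \<in> K. \<phi> {X \<in> Pow K. i \<in> X} = g i) \<and> \<phi> {} = \<bottom> \<and>
      (\<forall>a \<in> clopen_sets K. \<phi> (Pow K - a) = complement L (\<phi> a)) \<and>
      (\<forall>a \<in> clopen_sets K. \<forall>b \<in> clopen_sets K. \<phi> (a \<union> b) = \<phi> a \<squnion> \<phi> b)"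
    using free_algebra_universal[OF g] by (rule exE)
  then have \<phi>_closed: "\<And>a. a \<in> clopen_sets K \<Longrightarrow> \<phi> a \<in> carrier L"
    and \<phi>_generator: "\<And>i. i \<in> K \<Longrightarrow> \<phi> {X \<in> Pow K. i \<in> X} = g i"
    and \<phi>_empty: "\<phi> {} = \<bottom>"
    and \<phi>_compl: "\<And>a. a \<in> clopen_sets K \<Longrightarrow> \<phi> (Pow K - a) = complement L (\<phi> a)"
    and \<phi>_union: "\<And>a b. \<lbrakk>a \<in> clopen_sets K; b \<in> clopen_sets K\<rbrakk> \<Longrightarrow> \<phi> (a \<union> b) = \<phi> a \<squnion> \<phi> b"
    by simp_all
  have \<phi>_mono: "\<phi> a \<sqsubseteq> \<phi> b" if "a \<in> clopen_sets K" "b \<in> clopen_sets K" "a \<subseteq> b" for a b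
  proof -
    have "\<phi> b = \<phi> a \<squnion> \<phi> b"
      using \<phi>_union[OF that(1,2)] that(3) by (simp add: Un_absorb1)
    then show ?thesis
      using join_left[OF \<phi>_closed[OF that(1)] \<phi>_closed[OF that(2)]] by simp
  qed
  have \<phi>_diff: "\<phi> (a - b) = \<bottom> \<longleftrightarrow> \<phi> a \<sqsubseteq> \<phi> b" if ab: "a \<in> clopen_sets K" "b \<in> clopen_sets K" for a b
  proof
    note closed = \<phi>_closed[OF ab(1)] \<phi>_closed[OF ab(2)] \<phi>_closed[OF clopen_sets_Diff[OF ab]]
    have "\<phi> a \<sqsubseteq> \<phi> (b \<union> (a - b))"
      using ab by (intro \<phi>_mono clopen_sets.union clopen_sets_Diff) auto
    also have "\<phi> (b \<union> (a - b)) = \<phi> b \<squnion> \<phi> (a - b)"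
      using ab by (simp only: \<phi>_union clopen_sets_Diff)
    finally have *: "\<phi> a \<sqsubseteq> \<phi> b \<squnion> \<phi> (a - b)" .
    assume "\<phi> (a - b) = \<bottom>"
    then have "\<phi> b \<squnion> \<phi> (a - b) \<sqsubseteq> \<phi> b"
      using closed by (simp add: join_le_iff bottom_lower)
    then show "\<phi> a \<sqsubseteq> \<phi> b"
      using le_trans[OF * ] closed by simp
  next
    note closed = \<phi>_closed[OF ab(1)] \<phi>_closed[OF ab(2)] \<phi>_closed[OF clopen_sets_Diff[OF ab]]
    assume *: "\<phi> a \<sqsubseteq> \<phi> b"
    have "\<phi> (a - b) \<sqsubseteq> \<phi> a"
      using ab by (intro \<phi>_mono clopen_sets_Diff) auto
    then have "\<phi> (a - b) \<sqsubseteq> \<phi> b"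
      using le_trans[OF _ *] closed by simp
    moreover have "\<phi> (a - b) \<sqsubseteq> \<phi> (Pow K - b)"
      using ab clopen_sets_subset[of a K] by (intro \<phi>_mono clopen_sets_Diff clopen_sets.compl) auto
    ultimately show "\<phi> (a - b) = \<bottom>"
      using closed meet_complement[of "\<phi> b"] meet_bottom_iff[of "\<phi> b" "complement L (\<phi> b)"] ab
      by (simp add: \<phi>_compl)
  qed
  define I where "I = {a \<in> clopen_sets K. \<phi> a = \<bottom>}"
  have bot_join: "x \<squnion> y = \<bottom> \<longleftrightarrow> x = \<bottom> \<and> y = \<bottom>" if "x \<in> carrier L" "y \<in> carrier L" for x y
    using that by (simp add: join_le_iff flip: le_bottom_iff)
  have ideal: "boolean_ideal I ?F"
    unfolding boolean_ideal_def
  proof (intro conjI ballI impI)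
    fix a b assume "a \<in> I" "b \<in> carrier ?F" "b \<sqsubseteq>\<^bsub>?F\<^esub> a"
    then show "b \<in> I"
      using \<phi>_mono[of b a] \<phi>_closed by (auto simp: I_def le_bottom_iff)
  qed (auto simp: I_def free_algebra_bottom free_algebra_join clopen_sets.empty clopen_sets.union
      \<phi>_empty \<phi>_union \<phi>_closed bot_join)
  let ?Q = "quotient_algebra ?F I"
  define cls where "cls a = {b \<in> clopen_sets K. \<phi> b = \<phi> a}" for a
  have "ideal_cong ?F I `` {a} = cls a" if a: "a \<in> clopen_sets K" for a
  proof -
    have "(a, b) \<in> ideal_cong ?F I \<longleftrightarrow> \<phi> b = \<phi> a" if b: "b \<in> clopen_sets K" for b
    proof -
      have "(a, b) \<in> ideal_cong ?F I \<longleftrightarrow> \<phi> (a - b) \<squnion> \<phi> (b - a) = \<bottom>"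
        using a b by (simp add: ideal_cong_def free_algebra_difference free_algebra_join
            clopen_sets_Diff clopen_sets.union I_def \<phi>_union)
      also have "\<dots> \<longleftrightarrow> \<phi> a \<sqsubseteq> \<phi> b \<and> \<phi> b \<sqsubseteq> \<phi> a"
        using a b by (simp add: bot_join \<phi>_closed clopen_sets_Diff \<phi>_diff)
      also have "\<dots> \<longleftrightarrow> \<phi> b = \<phi> a"
        using le_antisym[of "\<phi> b" "\<phi> a"] a b \<phi>_closed by auto
      finally show ?thesis .
    qed
    then show ?thesis
      by (auto simp: cls_def ideal_cong_def)
  qed
  then have carrier_Q: "carrier ?Q = cls ` clopen_sets K"
    by (auto simp: quotient_algebra_def quotient_def)
  have le_Q: "cls a \<sqsubseteq>\<^bsub>?Q\<^esub> cls b \<longleftrightarrow> \<phi> a \<sqsubseteq> \<phi> b" if "a \<in> clopen_sets K" "b \<in> clopen_sets K" for a b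
  proof -
    have "cls a \<sqsubseteq>\<^bsub>?Q\<^esub> cls b \<longleftrightarrow> (\<exists>x \<in> cls a. \<exists>y \<in> cls b. difference ?F x y \<in> I)"
      by (simp add: quotient_algebra_def)
    also have "\<dots> \<longleftrightarrow> (\<exists>x \<in> cls a. \<exists>y \<in> cls b. \<phi> x \<sqsubseteq> \<phi> y)"
      by (intro bex_cong refl)
        (auto simp: cls_def free_algebra_difference I_def \<phi>_diff clopen_sets_Diff)
    also have "\<dots> \<longleftrightarrow> \<phi> a \<sqsubseteq> \<phi> b"
      using that by (auto simp: cls_def)
    finally show ?thesis .
  qed
  define \<psi> where "\<psi> X = the_elem (\<phi> ` X)" for X
  have \<psi>: "\<psi> (cls a) = \<phi> a" if "a \<in> clopen_sets K" for a
  proof -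
    have "\<phi> ` cls a = {\<phi> a}"
      using that by (auto simp: cls_def)
    then show ?thesis
      by (simp add: \<psi>_def)
  qed
  have "sigma_dense_embedding L ?Q \<psi>"
  proof
    show "\<psi> q \<in> carrier L" if "q \<in> carrier ?Q" for q
      using that by (auto simp: carrier_Q \<psi> \<phi>_closed)
    show "p \<sqsubseteq>\<^bsub>?Q\<^esub> q \<longleftrightarrow> \<psi> p \<sqsubseteq> \<psi> q" if "p \<in> carrier ?Q" "q \<in> carrier ?Q" for p q
      using that by (auto simp: carrier_Q \<psi> le_Q)
    show "\<exists>p \<in> carrier ?Q. \<psi> p = complement L (\<psi> q)" if q: "q \<in> carrier ?Q" for q
    proof -
      obtain a where a: "a \<in> clopen_sets K" "q = cls a"
        using q by (auto simp: carrier_Q)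
      then show ?thesis
        using clopen_sets.compl[OF a(1)]
        by (intro bexI[of _ "cls (Pow K - a)"]) (simp_all add: carrier_Q \<psi> \<phi>_compl)
    qed
    show "\<exists>D \<subseteq> carrier ?Q. countable D \<and> least L b (Upper L (\<psi> ` D))" if b: "b \<in> carrier L" for b
    proof -
      obtain D where D: "D \<subseteq> g ` K" "countable D" "least L b (Upper L D)"
        using dense[OF b] by blast
      obtain J where J: "J \<subseteq> K" "countable J" "D = g ` J"
        using D(1,2) countable_subset_image[of D g K] by auto
      let ?c = "\<lambda>i. cls {X \<in> Pow K. i \<in> X}"
      have "\<psi> (?c i) = g i \<and> ?c i \<in> carrier ?Q" if "i \<in> K" for i
        using clopen_sets.generator[OF that] \<psi>[of "{X \<in> Pow K. i \<in> X}"] \<phi>_generator[OF that]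
        by (simp add: carrier_Q)
      then have "\<psi> ` ?c ` J = D" "?c ` J \<subseteq> carrier ?Q"
        using J(1,3) by (auto simp: image_image subset_iff intro!: image_cong)
      then show ?thesis
        using D(3) J(2) by (intro exI[of _ "?c ` J"]) simp
    qed
  qed
  then show ?thesis
    using ideal by blast
qed

section \<open>Strictly positive measures\<close>

lemma (in boolean_lattice) supports_mono:
  assumes "supports L \<mu>" "x \<in> carrier L" "y \<in> carrier L" "x \<sqsubseteq> y"
  shows "\<mu> x \<le> \<mu> y"
proof -
  let ?d = "y \<sqinter> complement L x"
  have "x \<sqinter> ?d = \<bottom>"
    using assms by (simp flip: le_complement_iff add: meet_right)
  then have "\<mu> (x \<squnion> ?d) = \<mu> x + \<mu> ?d"
    using assms by (simp add: supports_def boolean_measure_def)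
  moreover have "0 \<le> \<mu> ?d"
    using assms by (simp add: supports_def boolean_measure_def)
  ultimately show ?thesis
    using assms by (simp add: join_meet_complement)
qed

lemma (in boolean_lattice) supports_bottom:
  assumes "supports L \<mu>"
  shows "\<mu> \<bottom> = 0"
proof -
  have "\<bottom> \<squnion> \<bottom> = \<bottom>" "\<bottom> \<sqinter> \<bottom> = \<bottom>"
    using le_iff_meet[of \<bottom> \<bottom>] le_iff_join[of \<bottom> \<bottom>] by auto
  then have "\<mu> \<bottom> = \<mu> \<bottom> + \<mu> \<bottom>"
    using assms by (metis bottom_closed boolean_measure_def supports_def)
  then show ?thesis
    by simp
qed

lemma (in boolean_lattice) uniformly_dense_countable_sup:
  assumes \<mu>: "supports L \<mu>" and F: "uniformly_dense L \<mu> F" and b: "b \<in> carrier L"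
  shows "\<exists>D \<subseteq> F. countable D \<and> least L b (Upper L D)"
proof -
  have "\<forall>n. \<exists>a \<in> F. a \<sqsubseteq> b \<and> \<mu> (difference L b a) < 1 / real (Suc n)"
    using F b unfolding uniformly_dense_def by simp
  then obtain a where a: "\<And>n. a n \<in> F" "\<And>n. a n \<sqsubseteq> b"
      "\<And>n. \<mu> (difference L b (a n)) < 1 / real (Suc n)"
    by metis
  have FL: "F \<subseteq> carrier L"
    using F by (simp add: uniformly_dense_def)
  then have closed: "a n \<in> carrier L" for n
    using a(1) by blast
  have "least L b (Upper L (range a))"
  proof (rule least_UpperI)
    fix c assume c: "c \<in> Upper L (range a)"
    then have cL: "c \<in> carrier L" and above: "a n \<sqsubseteq> c" for n
      using closed by (auto simp: Upper_def)
    let ?d = "b \<sqinter> complement L c"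
    have "\<mu> ?d < 1 / real (Suc n)" for n
    proof -
      have "c \<sqinter> ?d = \<bottom>"
        using b cL by (simp flip: le_complement_iff add: meet_right)
      then have "a n \<sqinter> ?d = \<bottom>"
        using b cL closed above[of n] le_trans[OF _ above[of n]]
        by (simp add: meet_bottom_iff)
      then have "?d \<sqsubseteq> difference L b (a n)"
        using b cL closed by (simp add: difference_def le_meet_iff le_complement_iff meet_left)
      then have "\<mu> ?d \<le> \<mu> (difference L b (a n))"
        using \<mu> b cL closed by (intro supports_mono) (simp_all add: difference_def)
      then show ?thesis
        using a(3)[of n] by linarith
    qed
    then have "\<not> 0 < \<mu> ?d"
      by (meson less_asym nat_approx_posE)
    then have "?d = \<bottom>"
      using \<mu> b cL by (auto simp: supports_def)
    then show "b \<sqsubseteq> c"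
      using b cL by (simp add: le_iff_meet_complement)
  qed (use a closed b in auto)
  then show ?thesis
    using a(1) by (intro exI[of _ "range a"]) auto
qed

lemma (in boolean_lattice) ur_attained:
  assumes "supports L \<mu>"
  shows "\<exists>F. uniformly_dense L \<mu> F \<and> ur L \<mu> = card_of F"
proof -
  let ?min = "\<lambda>F. uniformly_dense L \<mu> F \<and> (\<forall>G. uniformly_dense L \<mu> G \<longrightarrow> card_of F \<le>o card_of G)"
  have "uniformly_dense L \<mu> (carrier L)"
    unfolding uniformly_dense_def difference_def
  proof (intro conjI ballI allI impI subset_refl)
    fix b and \<epsilon> :: real assume "b \<in> carrier L" "0 < \<epsilon>"
    then show "\<exists>a \<in> carrier L. a \<sqsubseteq> b \<and> \<mu> (b \<sqinter> complement L a) < \<epsilon>"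
      using supports_bottom[OF assms] by (intro bexI[of _ b]) (simp_all add: meet_complement)
  qed
  then have "card_of ` {F. uniformly_dense L \<mu> F} \<noteq> {}"
    by blast
  then have "\<exists>F. ?min F"
    using exists_minim_Card_order[of "card_of ` {F. uniformly_dense L \<mu> F}"] card_of_Card_order
    by auto
  then have "?min (SOME F. ?min F)"
    by (rule someI_ex)
  then show ?thesis
    unfolding ur_def by blast
qed

theorem proposition5p2:
  fixes \<kappa> :: "'k rel" and B :: "'a gorder" and \<mu> :: "'a \<Rightarrow> real"
  assumes "Cinfinite \<kappa>"
    and "boolean_lattice B"
    and "supports B \<mu>"
    and "uniformly_regular \<kappa> B \<mu>"
    and "non_atomic B \<mu>"
  shows "\<exists>I S. boolean_ideal I (free_algebra (Field \<kappa>)) \<and>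
           boolean_subalgebra S (sigma_completion (quotient_algebra (free_algebra (Field \<kappa>)) I)) \<and>
           boolean_isomorphic B
             ((sigma_completion (quotient_algebra (free_algebra (Field \<kappa>)) I))\<lparr>carrier := S\<rparr>)"
proof -
  interpret boolean_lattice B
    by fact
  obtain F where F: "uniformly_dense B \<mu> F" "ur B \<mu> = card_of F"
    using ur_attained[OF assms(3)] by blast
  have "card_of (Field \<kappa>) =o \<kappa>"
    using assms(1) by (intro card_of_Field_ordIso) simp
  then have "card_of (Field \<kappa>) =o card_of F"
    using assms(4) ordIso_symmetric ordIso_transitive by (metis F(2) uniformly_regular_def)
  then obtain g where g: "bij_betw g (Field \<kappa>) F"
    using card_of_ordIso by blast
  have "g ` Field \<kappa> = F"
    using g by (simp add: bij_betw_def)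
  moreover from this have "g \<in> Field \<kappa> \<rightarrow> carrier B"
    using F(1) by (auto simp: uniformly_dense_def)
  ultimately obtain I \<psi> where I: "boolean_ideal I (free_algebra (Field \<kappa>))"
    and "sigma_dense_embedding B (quotient_algebra (free_algebra (Field \<kappa>)) I) \<psi>"
    using quotient_sigma_dense_embedding[of g "Field \<kappa>"]
      uniformly_dense_countable_sup[OF assms(3) F(1)] by auto
  then show ?thesis
    using sigma_dense_embedding.isomorphic_subalgebra_sigma_completion by blast
qed

end
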